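(* Let $k$ be a unique factorization domain of characteristic $p>0$, let $R=k[x_1,\ldots,x_d]$ be the polynomial ring over $k$, and let $h\in R$. For every $n\in\{1,2,3,\dots\}\cup\{\infty\}$, $$\mathrm{IDer}_k(\log h;n)=\mathrm{IDer}_k(\log h^p;np),$$ where $np=\infty$ if $n=\infty$.
   Context: For a commutative ring $k$ and a commutative $k$-algebra $R$, a Hasse-Schmidt derivation of $R$ over $k$ of length $n$ (an integer $n\geq 1$ or $n=\infty$) is a sequence $D=(D_0,D_1,\dots,D_n)$ (resp. $D=(D_0,D_1,\dots)$ if $n=\infty$) of $k$-linear maps $D_i:R\to R$ with $D_0=\mathrm{Id}_R$ and $D_i(xy)=\sum_{a+b=i}D_a(x)D_b(y)$ for all $x,y\in R$ and all $i$. The set of these is $\mathrm{HS}_k(R;n)$. The component $D_1$ is a $k$-derivation. For an ideal $I\subseteq R$, $\mathrm{HS}_k(\log I;n)$ is the set of $D\in\mathrm{HS}_k(R;n)$ with $D_i(I)\subseteq I$ for all $i$, and $\mathrm{IDer}_k(\log I;n)$ is the set of $k$-derivations $\delta$ of $R$ such that there is $D\in\mathrm{HS}_k(\log I;n)$ with $D_1=\delta$. For $f\in R$, $\log f$ means $\log\langle f\rangle$. *)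

theory Defs
  imports
    "HOL-Library.Poly_Mapping"
    "HOL-Library.Extended_Nat"
    "HOL-Library.FuncSet"
    "HOL-Computational_Algebra.Computational_Algebra"
begin

text \<open>
  A commutative \<open>k\<close>-algebra is a commutative ring type \<^typ>\<open>'r\<close> together with its scalar
  multiplication \<open>s :: 'k \<Rightarrow> 'r \<Rightarrow> 'r\<close>; \<open>k\<close>-linearity of \<open>D\<close> is \<open>module_hom s s D\<close>.
\<close>

definition k_derivations :: "('k::comm_ring_1 \<Rightarrow> 'r::comm_ring_1 \<Rightarrow> 'r) \<Rightarrow> ('r \<Rightarrow> 'r) set" where
  "k_derivations s = {\<delta>. module_hom s s \<delta> \<and> (\<forall>x y. \<delta> (x * y) = x * \<delta> y + \<delta> x * y)}"

text \<open>
  A sequence of length \<open>n\<close> is indexed by the \<open>i :: nat\<close> with \<open>enat i \<le> n\<close> (so by all of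
  \<open>nat\<close> if \<open>n = \<infinity>\<close>). Extensionality fixes the value outside this index set, so that
  sequences of length \<open>n\<close> are determined by their components.
\<close>

definition HS :: "('k::comm_ring_1 \<Rightarrow> 'r::comm_ring_1 \<Rightarrow> 'r) \<Rightarrow> enat \<Rightarrow> (nat \<Rightarrow> 'r \<Rightarrow> 'r) set" where
  "HS s n = {D \<in> extensional {i. enat i \<le> n}.
     D 0 = id \<and>
     (\<forall>i. enat i \<le> n \<longrightarrow> module_hom s s (D i)) \<and>
     (\<forall>i. enat i \<le> n \<longrightarrow> (\<forall>x y. D i (x * y) = (\<Sum>a\<le>i. D a x * D (i - a) y)))}"

definition HS_log ::
  "('k::comm_ring_1 \<Rightarrow> 'r::comm_ring_1 \<Rightarrow> 'r) \<Rightarrow> 'r set \<Rightarrow> enat \<Rightarrow> (nat \<Rightarrow> 'r \<Rightarrow> 'r) set" where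
  "HS_log s I n = {D \<in> HS s n. \<forall>i. enat i \<le> n \<longrightarrow> D i ` I \<subseteq> I}"

definition IDer_log ::
  "('k::comm_ring_1 \<Rightarrow> 'r::comm_ring_1 \<Rightarrow> 'r) \<Rightarrow> 'r set \<Rightarrow> enat \<Rightarrow> ('r \<Rightarrow> 'r) set" where
  "IDer_log s I n = {\<delta> \<in> k_derivations s. \<exists>D \<in> HS_log s I n. D 1 = \<delta>}"

definition principal_ideal :: "'r::comm_ring_1 \<Rightarrow> 'r set" where
  "principal_ideal f = {r * f | r. True}"

text \<open>
  Polynomials in variables indexed by \<^typ>\<open>'v\<close>: finitely supported functions from exponent
  vectors to coefficients, with the convolution product.
\<close>

type_synonym ('v, 'k) mpoly = "('v \<Rightarrow>\<^sub>0 nat) \<Rightarrow>\<^sub>0 'k"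

definition mpoly_scale :: "'k::comm_ring_1 \<Rightarrow> ('v, 'k) mpoly \<Rightarrow> ('v, 'k) mpoly" where
  "mpoly_scale c f = Poly_Mapping.single 0 c * f"

lemma module_mpoly_scale: "module mpoly_scale"
  by unfold_locales
    (simp_all add: mpoly_scale_def algebra_simps single_add mult_single flip: mult.assoc)

lemma mpoly_scale_mult_left: "mpoly_scale c (f * g) = mpoly_scale c f * g"
  by (simp add: mpoly_scale_def mult.assoc)

end

theory Submission
  imports Defs
begin

text \<open>
  Write a Hasse-Schmidt derivation as the power series \<open>D(f) = \<Sum>\<^sub>i D\<^sub>i(f) t\<^sup>i\<close>. The Leibniz rules say
  that \<open>f \<mapsto> D(f)\<close> is multiplicative up to the length, so \<open>D(f\<^sup>p) = D(f)\<^sup>p\<close>, and in characteristic \<open>p\<close>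
  the right-hand side is \<open>\<Sum>\<^sub>i D\<^sub>i(f)\<^sup>p t\<^sup>i\<^sup>p\<close> (lemma \<open>HS_power_CHAR\<close>). Consequently a derivation of
  length \<open>np\<close> is logarithmic along \<open>h\<^sup>p\<close> exactly when \<open>h\<^sup>p\<close> divides \<open>D\<^sub>i(h)\<^sup>p\<close> for every \<open>i \<le> n\<close>
  (lemma \<open>HS_log_power_CHAR_iff\<close>), a condition that only sees the components of index at most \<open>n\<close>.

  Two properties of the polynomial ring turn this into the theorem. Since it is free on its
  variables, a Hasse-Schmidt derivation of finite length extends to infinite length: choose the
  images of the variables arbitrarily beyond the given length (lemma \<open>HS_mpoly_extend\<close>). So passing
  between the lengths \<open>n\<close> and \<open>np\<close> is possible in both directions without touching the components
  of index at most \<open>n\<close>, in particular the first one. And \<open>h\<^sup>p\<close> divides \<open>g\<^sup>p\<close> only if \<open>h\<close> divides \<open>g\<close>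
  (lemma \<open>mpoly_power_CHAR_dvd_power\<close>). This is inherited from the coefficient ring by dividing \<open>g\<close>
  by \<open>h\<close> term by term: in characteristic \<open>p\<close>, subtracting a multiple of \<open>h\<close> from \<open>g\<close> subtracts the
  corresponding \<open>p\<close>-th power from the quotient \<open>g\<^sup>p / h\<^sup>p\<close>, and removes one of its finitely many terms.
\<close>

section \<open>Hasse-Schmidt derivations and powers\<close>

lemma HS_D:
  assumes "D \<in> HS s n" "enat i \<le> n"
  shows HS_module_hom: "module_hom s s (D i)"
    and HS_mult: "D i (x * y) = (\<Sum>a\<le>i. D a x * D (i - a) y)"
  using assms by (auto simp: HS_def)

lemma HS_0: "D \<in> HS s n \<Longrightarrow> D 0 x = x"
  by (simp add: HS_def)

lemma HS_restrict:
  assumes D: "D \<in> HS s m" and nm: "n \<le> m"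
  shows "restrict D {i. enat i \<le> n} \<in> HS s n"
proof -
  have le: "enat i \<le> m" if "enat i \<le> n" for i
    using that nm by (rule order_trans)
  have "enat (i - a) \<le> n" "a \<le> i \<Longrightarrow> enat a \<le> n" if "enat i \<le> n" for a i
    using that by (meson diff_le_self enat_ord_simps(1) order_trans)+
  then show ?thesis
    using D le by (auto simp: HS_def zero_enat_def[symmetric] intro!: sum.cong)
qed

text \<open>
  For \<open>i > 0\<close>, all terms of \<open>D\<^sub>i(1 \<cdot> 1)\<close> except the two outermost vanish by induction,
  which leaves \<open>D\<^sub>i(1) = 2 D\<^sub>i(1)\<close>.
\<close>

lemma HS_one:
  assumes "D \<in> HS s n" "enat i \<le> n"
  shows "D i 1 = (if i = 0 then 1 else 0)"
  using assms(2)
proof (induction i rule: less_induct)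
  case (less i)
  show ?case
  proof (cases "i = 0")
    case True
    then show ?thesis using HS_0[OF assms(1)] by simp
  next
    case False
    have "D i (1 * 1) = (\<Sum>a\<le>i. D a 1 * D (i - a) 1)"
      by (rule HS_mult[OF assms(1) less.prems])
    also have "\<dots> = (\<Sum>a\<in>{0, i}. D a 1 * D (i - a) 1)"
    proof (rule sum.mono_neutral_right)
      show "\<forall>a\<in>{..i} - {0, i}. D a 1 * D (i - a) 1 = 0"
      proof
        fix a assume a: "a \<in> {..i} - {0, i}"
        then have "enat a \<le> n"
          using less.prems by (meson DiffD1 atMost_iff enat_ord_simps(1) order_trans)
        with a show "D a 1 * D (i - a) 1 = 0"
          using less.IH[of a] by auto
      qed
    qed auto
    finally show ?thesis
      using False by (simp add: HS_0[OF assms(1)])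
  qed
qed

text \<open>
  The Leibniz rule for \<open>D\<^sub>i\<close> is the formula for the \<open>i\<close>-th coefficient of a product of power series.
  The series here continues past the length of \<open>D\<close>, where \<open>D\<close> has arbitrary values; these do not
  enter the coefficients up to the length.
\<close>

lemma HS_power:
  assumes "D \<in> HS s n" "enat i \<le> n"
  shows "D i (f ^ m) = fps_nth (Abs_fps (\<lambda>j. D j f) ^ m) i"
  using assms(2)
proof (induction m arbitrary: i)
  case 0
  then show ?case using HS_one[OF assms(1)] by simp
next
  case (Suc m)
  have "enat (i - a) \<le> n" for a
    using Suc.prems by (meson diff_le_self enat_ord_simps(1) order_trans)
  then show ?case
    by (simp add: HS_mult[OF assms(1) Suc.prems] fps_mult_nth Suc.IH atLeast0AtMost)
qed

text \<open>
  The Frobenius map is additive on finite sums only, so the \<open>j\<close>-th coefficient is computed from the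
  terms of \<open>F\<close> up to \<open>t\<^sup>j\<close>; the \<open>p\<close>-th power of the rest is a multiple of \<open>t\<^sup>(\<^sup>j\<^sup>+\<^sup>1\<^sup>)\<^sup>p\<close>.
\<close>

lemma fps_nth_power_CHAR:
  fixes F :: "'a::comm_ring_1 fps"
  assumes "prime CHAR('a)" and p: "p = CHAR('a)"
  shows "fps_nth (F ^ p) j = (if p dvd j then fps_nth F (j div p) ^ p else 0)"
proof -
  have p0: "p > 0" using assms prime_gt_0_nat by blast
  define G where "G = fps_shift (Suc j) F"
  have F: "F = (\<Sum>i\<le>j. fps_const (fps_nth F i) * fps_X ^ i) + G * fps_X ^ Suc j"
    by (rule fps_ext)
      (auto simp: G_def fps_sum_nth fps_X_power_nth fps_X_power_mult_right_nth if_distrib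
        simp del: power_Suc cong: if_cong)
  have "F ^ p = (\<Sum>i\<le>j. fps_const (fps_nth F i ^ p) * fps_X ^ (i * p)) + G ^ p * fps_X ^ (Suc j * p)"
    by (subst F) (simp add: freshmans_dream freshmans_dream_sum assms power_mult_distrib
        flip: power_mult power_add)
  then have "fps_nth (F ^ p) j
      = (\<Sum>i\<le>j. if j = i * p then fps_nth F i ^ p else 0) + fps_nth (G ^ p * fps_X ^ (Suc j * p)) j"
    by (simp add: fps_sum_nth fps_X_power_nth if_distrib cong: if_cong)
  also have "fps_nth (G ^ p * fps_X ^ (Suc j * p)) j = 0"
  proof -
    have "j < Suc j * p"
      using p0 by (simp add: add_strict_increasing)
    then show ?thesis
      by (simp add: fps_X_power_mult_right_nth del: mult_Suc)
  qed
  also have "(\<Sum>i\<le>j. if j = i * p then fps_nth F i ^ p else 0)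
      = (\<Sum>i\<le>j. if i = j div p \<and> p dvd j then fps_nth F i ^ p else 0)"
    using p0 by (intro sum.cong) auto
  also have "\<dots> = (if p dvd j then fps_nth F (j div p) ^ p else 0)"
    by (cases "p dvd j") (simp_all add: sum.delta)
  finally show ?thesis by simp
qed

text \<open>
  The multiplicativity of \<open>f \<mapsto> D(f)\<close>, which carries \<open>f\<^sup>p\<close> to \<open>D(f)\<^sup>p\<close>, meets the Frobenius map of
  the power series ring.
\<close>

lemma HS_power_CHAR:
  fixes s :: "'k::comm_ring_1 \<Rightarrow> 'r::comm_ring_1 \<Rightarrow> 'r"
  assumes "D \<in> HS s n" "enat j \<le> n" "prime CHAR('r)" "p = CHAR('r)"
  shows "D j (f ^ p) = (if p dvd j then D (j div p) f ^ p else 0)"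
  using HS_power[OF assms(1,2), of f p] fps_nth_power_CHAR[OF assms(3,4)] by simp

text \<open>
  By the Leibniz rule, stability of a principal ideal can be tested on its generator.
\<close>

lemma HS_log_principal_iff:
  assumes D: "D \<in> HS s n"
  shows "D \<in> HS_log s (principal_ideal f) n \<longleftrightarrow> (\<forall>i. enat i \<le> n \<longrightarrow> f dvd D i f)"
proof
  assume "D \<in> HS_log s (principal_ideal f) n"
  moreover have "f \<in> principal_ideal f"
    by (auto simp: principal_ideal_def intro: exI[of _ 1])
  ultimately show "\<forall>i. enat i \<le> n \<longrightarrow> f dvd D i f"
    by (fastforce simp: HS_log_def principal_ideal_def)
next
  assume dvd: "\<forall>i. enat i \<le> n \<longrightarrow> f dvd D i f"
  have "f dvd D i (r * f)" if i: "enat i \<le> n" for i r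
  proof -
    have "enat (i - a) \<le> n" for a
      using i by (meson diff_le_self enat_ord_simps(1) order_trans)
    then show ?thesis
      unfolding HS_mult[OF D i] using dvd by (intro dvd_sum dvd_mult) auto
  qed
  then show "D \<in> HS_log s (principal_ideal f) n"
    using D by (fastforce simp: HS_log_def principal_ideal_def dvd_def mult.commute)
qed

text \<open>
  Only the components with index \<open>ip\<close> can be nonzero on \<open>f\<^sup>p\<close>, and \<open>ip \<le> np\<close> means \<open>i \<le> n\<close>.
\<close>

lemma HS_log_power_CHAR_iff:
  fixes s :: "'k::comm_ring_1 \<Rightarrow> 'r::comm_ring_1 \<Rightarrow> 'r"
  assumes D: "D \<in> HS s (n * enat p)" and p: "prime CHAR('r)" "p = CHAR('r)"
  shows "D \<in> HS_log s (principal_ideal (f ^ p)) (n * enat p)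
    \<longleftrightarrow> (\<forall>i. enat i \<le> n \<longrightarrow> f ^ p dvd D i f ^ p)"
proof -
  have p0: "p > 0" using p prime_gt_0_nat by blast
  have le: "enat (i * p) \<le> n * enat p \<longleftrightarrow> enat i \<le> n" for i
    using p0 by (cases n) auto
  show ?thesis
    unfolding HS_log_principal_iff[OF D]
  proof (intro iffI allI impI)
    fix i assume *: "\<forall>j. enat j \<le> n * enat p \<longrightarrow> f ^ p dvd D j (f ^ p)" and i: "enat i \<le> n"
    then have "f ^ p dvd D (i * p) (f ^ p)"
      using le by blast
    then show "f ^ p dvd D i f ^ p"
      using HS_power_CHAR[OF D _ p, of "i * p" f] le i p0 by simp
  next
    fix j assume *: "\<forall>i. enat i \<le> n \<longrightarrow> f ^ p dvd D i f ^ p" and j: "enat j \<le> n * enat p"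
    show "f ^ p dvd D j (f ^ p)"
      unfolding HS_power_CHAR[OF D j p]
      using * j le[of "j div p"] by auto
  qed
qed

section \<open>Extending Hasse-Schmidt derivations of polynomial rings\<close>

lemma sum_lookup_single:
  fixes f :: "'m \<Rightarrow>\<^sub>0 'b::comm_monoid_add"
  shows "(\<Sum>m\<in>Poly_Mapping.keys f. Poly_Mapping.single m (Poly_Mapping.lookup f m)) = f"
  by (intro poly_mapping_eqI) (simp add: lookup_sum lookup_single when_def in_keys_iff)

abbreviation mvar :: "'v \<Rightarrow> ('v, 'k::comm_ring_1) mpoly" where
  "mvar v \<equiv> Poly_Mapping.single (Poly_Mapping.single v 1) 1"

text \<open>
  Polynomials are generated as a ring by constants and variables. With this rule, two maps that
  respect sums and products in some weak sense, for instance only in low degrees, can be compared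
  on generators.
\<close>

lemma mpoly_generators_induct [case_names const var add mult]:
  fixes f :: "('v, 'k::comm_ring_1) mpoly"
  assumes const: "\<And>c. P (Poly_Mapping.single 0 c)" and var: "\<And>v. P (mvar v)"
    and add: "\<And>f g. P f \<Longrightarrow> P g \<Longrightarrow> P (f + g)" and mult: "\<And>f g. P f \<Longrightarrow> P g \<Longrightarrow> P (f * g)"
  shows "P f"
proof -
  have sum: "P (sum g A)" if "\<And>a. a \<in> A \<Longrightarrow> P (g a)" for g and A :: "('v \<Rightarrow>\<^sub>0 nat) set"
    using that by (induction A rule: infinite_finite_induct) (use const[of 0] add in auto)
  have mono_v: "P (Poly_Mapping.single (Poly_Mapping.single v n) 1)" for v n
  proof (induction n)
    case 0
    then show ?case using const[of 1] by simp
  next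
    case (Suc n)
    then show ?case
      using mult[OF var Suc, of v] by (simp add: mult_single flip: single_add)
  qed
  have mono: "P (Poly_Mapping.single (\<Sum>v\<in>A. Poly_Mapping.single v (e v)) 1)"
    for A and e :: "'v \<Rightarrow> nat"
  proof (induction A rule: infinite_finite_induct)
    case (insert v A)
    then show ?case
      using mult[OF mono_v insert.IH, of v "e v"] by (simp add: mult_single)
  qed (use const[of 1] in auto)
  have "P (Poly_Mapping.single m c)" for m :: "'v \<Rightarrow>\<^sub>0 nat" and c
    using mult[OF const[of c] mono[of "Poly_Mapping.lookup m" "Poly_Mapping.keys m"]]
    by (simp add: mult_single sum_lookup_single)
  then show ?thesis
    using sum[of "Poly_Mapping.keys f" "\<lambda>m. Poly_Mapping.single m (Poly_Mapping.lookup f m)"]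
    by (simp add: sum_lookup_single)
qed

definition mpoly_eval ::
  "('k::comm_ring_1 \<Rightarrow> 'a::comm_ring_1) \<Rightarrow> ('v::finite \<Rightarrow> 'a) \<Rightarrow> ('v, 'k) mpoly \<Rightarrow> 'a" where
  "mpoly_eval \<phi> y f =
     (\<Sum>m\<in>Poly_Mapping.keys f. \<phi> (Poly_Mapping.lookup f m) * (\<Prod>v\<in>UNIV. y v ^ Poly_Mapping.lookup m v))"

context
  fixes \<phi> :: "'k::comm_ring_1 \<Rightarrow> 'a::comm_ring_1" and y :: "'v::finite \<Rightarrow> 'a"
  assumes \<phi>_add: "\<And>a b. \<phi> (a + b) = \<phi> a + \<phi> b"
    and \<phi>_mult: "\<And>a b. \<phi> (a * b) = \<phi> a * \<phi> b"
    and \<phi>_1: "\<phi> 1 = 1"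
begin

lemma mpoly_eval_superset:
  assumes "finite A" "Poly_Mapping.keys f \<subseteq> A"
  shows "mpoly_eval \<phi> y f =
    (\<Sum>m\<in>A. \<phi> (Poly_Mapping.lookup f m) * (\<Prod>v\<in>UNIV. y v ^ Poly_Mapping.lookup m v))"
  unfolding mpoly_eval_def
  by (rule sum.mono_neutral_left) (use assms \<phi>_add[of 0 0] in \<open>auto simp: in_keys_iff\<close>)

lemma mpoly_eval_single:
  "mpoly_eval \<phi> y (Poly_Mapping.single m c) = \<phi> c * (\<Prod>v\<in>UNIV. y v ^ Poly_Mapping.lookup m v)"
  by (subst mpoly_eval_superset[of "{m}"]) auto

lemma mpoly_eval_const: "mpoly_eval \<phi> y (Poly_Mapping.single 0 c) = \<phi> c"
  by (simp add: mpoly_eval_single)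

lemma mpoly_eval_var: "mpoly_eval \<phi> y (mvar v) = y v"
  by (simp add: mpoly_eval_single \<phi>_1 lookup_single when_def if_distrib [of "\<lambda>i. y _ ^ i"]
      prod.delta cong: if_cong)

lemma mpoly_eval_add: "mpoly_eval \<phi> y (f + g) = mpoly_eval \<phi> y f + mpoly_eval \<phi> y g"
proof -
  let ?A = "Poly_Mapping.keys f \<union> Poly_Mapping.keys g"
  have "Poly_Mapping.keys (f + g) \<subseteq> ?A" by (rule Poly_Mapping.keys_add)
  then show ?thesis
    by (simp add: mpoly_eval_superset[of ?A] lookup_add \<phi>_add distrib_right sum.distrib)
qed

lemma mpoly_eval_sum: "mpoly_eval \<phi> y (\<Sum>a\<in>A. g a) = (\<Sum>a\<in>A. mpoly_eval \<phi> y (g a))"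
proof (induction A rule: infinite_finite_induct)
  case (insert a A)
  then show ?case by (simp add: mpoly_eval_add)
qed (simp_all add: mpoly_eval_def)

lemma mpoly_eval_mult: "mpoly_eval \<phi> y (f * g) = mpoly_eval \<phi> y f * mpoly_eval \<phi> y g"
proof -
  let ?s = "\<lambda>f m. Poly_Mapping.single m (Poly_Mapping.lookup f m)"
  have single: "mpoly_eval \<phi> y (?s f a * ?s g b) = mpoly_eval \<phi> y (?s f a) * mpoly_eval \<phi> y (?s g b)" for a b
    by (simp add: mult_single mpoly_eval_single \<phi>_mult lookup_add power_add prod.distrib mult_ac)
  have "mpoly_eval \<phi> y (f * g)
      = mpoly_eval \<phi> y ((\<Sum>a\<in>Poly_Mapping.keys f. ?s f a) * (\<Sum>b\<in>Poly_Mapping.keys g. ?s g b))"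
    by (simp only: sum_lookup_single)
  also have "\<dots> = mpoly_eval \<phi> y (\<Sum>a\<in>Poly_Mapping.keys f. ?s f a)
      * mpoly_eval \<phi> y (\<Sum>b\<in>Poly_Mapping.keys g. ?s g b)"
    by (simp only: sum_product mpoly_eval_sum single)
  also have "\<dots> = mpoly_eval \<phi> y f * mpoly_eval \<phi> y g"
    by (simp only: sum_lookup_single)
  finally show ?thesis .
qed

end

text \<open>
  Evaluation at \<open>x\<^sub>v \<mapsto> D(x\<^sub>v)\<close> is a ring homomorphism into the power series over the polynomial
  ring, so its coefficients satisfy the Leibniz rules in all degrees. Up to the length of \<open>D\<close> they
  agree with \<open>D\<close>, because both sides agree on generators and obey the same rules for sums and
  products. Beyond the length the images of the variables are whatever \<open>D\<close> happens to contain;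
  any choice works.
\<close>

lemma HS_mpoly_extend:
  fixes D :: "nat \<Rightarrow> ('v::finite, 'k::comm_ring_1) mpoly \<Rightarrow> ('v, 'k) mpoly"
  assumes D: "D \<in> HS mpoly_scale n"
  obtains E where "E \<in> HS mpoly_scale \<infinity>" "\<And>i f. enat i \<le> n \<Longrightarrow> E i f = D i f"
proof -
  define \<phi> :: "'k \<Rightarrow> ('v, 'k) mpoly fps" where "\<phi> c = fps_const (Poly_Mapping.single 0 c)" for c
  define \<Phi> where "\<Phi> = mpoly_eval \<phi> (\<lambda>v. Abs_fps (\<lambda>i. D i (mvar v)))"
  have hom: "\<phi> (a + b) = \<phi> a + \<phi> b" "\<phi> (a * b) = \<phi> a * \<phi> b" "\<phi> 1 = 1" for a b
    by (simp_all add: \<phi>_def single_add mult_single)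
  note \<Phi> = mpoly_eval_const[OF hom] mpoly_eval_var[OF hom] mpoly_eval_add[OF hom]
    mpoly_eval_mult[OF hom]
  have eq: "\<forall>i. enat i \<le> n \<longrightarrow> fps_nth (\<Phi> f) i = D i f" for f
  proof (induction f rule: mpoly_generators_induct)
    case (const c)
    show ?case
    proof (intro allI impI)
      fix i assume i: "enat i \<le> n"
      interpret module_hom mpoly_scale mpoly_scale "D i"
        by (rule HS_module_hom[OF D i])
      have "D i (mpoly_scale c 1) = mpoly_scale c (D i 1)"
        by (rule scale)
      then show "fps_nth (\<Phi> (Poly_Mapping.single 0 c)) i = D i (Poly_Mapping.single 0 c)"
        by (simp add: \<Phi>_def \<Phi> \<phi>_def HS_one[OF D i] mpoly_scale_def)
    qed
  next
    case (var v)
    show ?case by (simp only: \<Phi>_def \<Phi> fps_nth_Abs_fps) simp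
  next
    case (add f g)
    show ?case
    proof (intro allI impI)
      fix i assume i: "enat i \<le> n"
      interpret module_hom mpoly_scale mpoly_scale "D i"
        by (rule HS_module_hom[OF D i])
      show "fps_nth (\<Phi> (f + g)) i = D i (f + g)"
        using add.IH i by (simp add: \<Phi>_def \<Phi> local.add)
    qed
  next
    case (mult f g)
    show ?case
    proof (intro allI impI)
      fix i assume i: "enat i \<le> n"
      have "enat a \<le> n" if "a \<le> i" for a
        using that i by (meson enat_ord_simps(1) order_trans)
      then show "fps_nth (\<Phi> (f * g)) i = D i (f * g)"
        using mult.IH
        by (simp add: HS_mult[OF D i] \<Phi>_def \<Phi> fps_mult_nth atLeast0AtMost)
    qed
  qed
  define E where "E i f = fps_nth (\<Phi> f) i" for i f
  have "\<Phi> (Poly_Mapping.single 0 c * f) = fps_const (Poly_Mapping.single 0 c) * \<Phi> f" for c f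
    unfolding \<Phi>_def \<Phi> by (simp add: \<phi>_def)
  moreover have "\<Phi> (f + g) = \<Phi> f + \<Phi> g" for f g
    unfolding \<Phi>_def \<Phi> ..
  ultimately have "module_hom mpoly_scale mpoly_scale (E i)" for i
    by (intro module_hom.intro module_hom_axioms.intro module_mpoly_scale)
      (simp_all add: E_def mpoly_scale_def)
  moreover have "E 0 = id"
    using eq HS_0[OF D] by (auto simp: E_def zero_enat_def[symmetric])
  moreover have "E i (f * g) = (\<Sum>a\<le>i. E a f * E (i - a) g)" for i f g
    by (simp add: E_def \<Phi>_def \<Phi> fps_mult_nth atLeast0AtMost)
  ultimately have "E \<in> HS mpoly_scale \<infinity>"
    by (simp add: HS_def)
  then show ?thesis
    using that eq by (auto simp: E_def)
qed

section \<open>Divisibility of powers\<close>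

text \<open>
  Divisibility is a comparison of the multiplicities of all primes, and taking \<open>n\<close>-th powers
  multiplies each of them by \<open>n\<close>.
\<close>

lemma factorial_power_dvd_power:
  fixes a b :: "'a::factorial_semiring"
  assumes dvd: "a ^ n dvd b ^ n" and n: "n > 0"
  shows "a dvd b"
proof (cases "a = 0 \<or> b = 0")
  case True
  then show ?thesis using assms by (auto simp: power_0_left)
next
  case False
  show ?thesis
  proof (rule multiplicity_le_imp_dvd)
    fix q :: 'a assume "prime q"
    then have "n * multiplicity q a \<le> n * multiplicity q b"
      using False dvd_imp_multiplicity_le[OF dvd, of q]
      by (simp add: prime_elem_multiplicity_power_distrib)
    then show "multiplicity q a \<le> multiplicity q b"
      using n by simp
  qed (use False in auto)
qed

lemma CHAR_poly_mapping:
  "CHAR('m::comm_monoid_add \<Rightarrow>\<^sub>0 'k::comm_semiring_1) = CHAR('k)"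
proof (rule CHAR_eqI)
  show "of_nat CHAR('k) = (0 :: 'm \<Rightarrow>\<^sub>0 'k)"
    by (rule poly_mapping_eqI) (simp add: lookup_of_nat)
next
  fix n assume "of_nat n = (0 :: 'm \<Rightarrow>\<^sub>0 'k)"
  then have "of_nat n = (0 :: 'k)"
    by (metis lookup_of_nat lookup_zero when_simps(1))
  then show "CHAR('k) dvd n"
    by (simp add: of_nat_eq_0_iff_char_dvd)
qed

lemma single_power:
  fixes c :: "'k::comm_semiring_1"
  shows "Poly_Mapping.single m c ^ n = Poly_Mapping.single (\<Sum>i<n. m) (c ^ n)"
  by (induction n) (simp_all add: mult_single add.commute mult.commute)

lemma sum_const_poly_mapping_inject:
  fixes m m' :: "'v \<Rightarrow>\<^sub>0 nat"
  assumes "(n::nat) > 0"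
  shows "(\<Sum>i<n. m) = (\<Sum>i<n. m') \<longleftrightarrow> m = m'"
proof
  assume "(\<Sum>i<n. m) = (\<Sum>i<n. m')"
  then have "Poly_Mapping.lookup (\<Sum>i<n. m) v = Poly_Mapping.lookup (\<Sum>i<n. m') v" for v
    by simp
  then have "n * Poly_Mapping.lookup m v = n * Poly_Mapping.lookup m' v" for v
    by (simp only: lookup_sum sum_constant card_lessThan of_nat_id)
  then show "m = m'"
    using assms by (intro poly_mapping_eqI) simp
qed simp

text \<open>
  The exponent vector \<open>pm\<close> is written as the sum of \<open>p\<close> copies of \<open>m\<close>, since exponent vectors
  form a monoid without scalar multiplication.
\<close>

lemma mpoly_power_CHAR:
  fixes g :: "('v, 'k::comm_ring_1) mpoly"
  assumes "prime CHAR('k)" "p = CHAR('k)"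
  shows "g ^ p = (\<Sum>m\<in>Poly_Mapping.keys g. Poly_Mapping.single (\<Sum>i<p. m) (Poly_Mapping.lookup g m ^ p))"
  using freshmans_dream_sum[of p "\<lambda>m. Poly_Mapping.single m (Poly_Mapping.lookup g m)" "Poly_Mapping.keys g"]
  by (simp add: CHAR_poly_mapping assms sum_lookup_single single_power)

lemma lookup_mpoly_power_CHAR:
  fixes g :: "('v, 'k::comm_ring_1) mpoly"
  assumes "prime CHAR('k)" "p = CHAR('k)"
  shows "Poly_Mapping.lookup (g ^ p) (\<Sum>i<p. m) = Poly_Mapping.lookup g m ^ p"
proof -
  have "p > 0" using assms prime_gt_0_nat by blast
  then show ?thesis
    by (simp add: mpoly_power_CHAR[OF assms] lookup_sum lookup_single sum_const_poly_mapping_inject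
        when_def in_keys_iff power_0_left)
qed

lemma keys_mpoly_power_CHAR:
  fixes g :: "('v, 'k::comm_ring_1) mpoly"
  assumes "prime CHAR('k)" "p = CHAR('k)" "Poly_Mapping.lookup (g ^ p) M \<noteq> 0"
  obtains m where "M = (\<Sum>i<p. m)"
proof -
  have "\<exists>m. M = (\<Sum>i<p. m)"
  proof (rule ccontr)
    assume "\<nexists>m. M = (\<Sum>i<p. m)"
    then have "Poly_Mapping.lookup (g ^ p) M = 0"
      by (auto simp: mpoly_power_CHAR[OF assms(1,2)] lookup_sum lookup_single when_def
          intro!: sum.neutral)
    with assms(3) show False by simp
  qed
  then show ?thesis using that by blast
qed

text \<open>
  The index type of the variables carries no order. Numbering the variables embeds the exponent
  vectors into those over the natural numbers, where the lexicographic order is a linear order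
  compatible with addition.
\<close>

lemma additive_embedding_ordered_monomials:
  obtains \<iota> :: "('v::finite \<Rightarrow>\<^sub>0 nat) \<Rightarrow> (nat \<Rightarrow>\<^sub>0 nat)"
  where "inj \<iota>" "\<And>a b. \<iota> (a + b) = \<iota> a + \<iota> b"
proof -
  obtain e :: "'v \<Rightarrow> nat" where e: "inj e"
    using finite_imp_inj_to_nat_seg[of "UNIV :: 'v set"] by auto
  define \<iota> :: "('v \<Rightarrow>\<^sub>0 nat) \<Rightarrow> (nat \<Rightarrow>\<^sub>0 nat)"
    where "\<iota> m = (\<Sum>v\<in>UNIV. Poly_Mapping.single (e v) (Poly_Mapping.lookup m v))" for m
  have "Poly_Mapping.lookup (\<iota> m) (e v) = Poly_Mapping.lookup m v" for m v
    using e by (simp add: \<iota>_def lookup_sum lookup_single inj_eq when_def)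
  then have "inj \<iota>"
    by (metis injI poly_mapping_eqI)
  moreover have "\<iota> (a + b) = \<iota> a + \<iota> b" for a b
    by (simp add: \<iota>_def lookup_add single_add sum.distrib)
  ultimately show ?thesis using that by blast
qed

text \<open>
  Leading terms multiply: the product of the two leading monomials arises from no other pair of
  terms, because no other pair reaches the maximum of the monomial order.
\<close>

lemma mpoly_unique_product:
  fixes f g :: "('v::finite, 'k::idom) mpoly"
  assumes "f \<noteq> 0" "g \<noteq> 0"
  obtains a b where "Poly_Mapping.lookup f a \<noteq> 0" "Poly_Mapping.lookup g b \<noteq> 0"
    "Poly_Mapping.lookup (f * g) (a + b) = Poly_Mapping.lookup f a * Poly_Mapping.lookup g b"
proof -
  obtain \<iota> :: "('v \<Rightarrow>\<^sub>0 nat) \<Rightarrow> (nat \<Rightarrow>\<^sub>0 nat)"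
    where inj: "inj \<iota>" and add: "\<And>a b. \<iota> (a + b) = \<iota> a + \<iota> b"
    using additive_embedding_ordered_monomials by blast
  have top: "\<exists>a\<in>Poly_Mapping.keys f. \<forall>a'\<in>Poly_Mapping.keys f. \<iota> a' \<le> \<iota> a" if "f \<noteq> 0"
    for f :: "('v, 'k) mpoly"
  proof -
    have "\<iota> ` Poly_Mapping.keys f \<noteq> {}" using that by simp
    then have "Max (\<iota> ` Poly_Mapping.keys f) \<in> \<iota> ` Poly_Mapping.keys f"
      by (intro Max_in) auto
    then obtain a where "a \<in> Poly_Mapping.keys f" "Max (\<iota> ` Poly_Mapping.keys f) = \<iota> a" by auto
    then show ?thesis
      by (metis Max_ge finite_imageI finite_keys imageI)
  qed
  obtain a where a: "a \<in> Poly_Mapping.keys f" "\<And>a'. a' \<in> Poly_Mapping.keys f \<Longrightarrow> \<iota> a' \<le> \<iota> a"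
    using top[OF assms(1)] by blast
  obtain b where b: "b \<in> Poly_Mapping.keys g" "\<And>b'. b' \<in> Poly_Mapping.keys g \<Longrightarrow> \<iota> b' \<le> \<iota> b"
    using top[OF assms(2)] by blast
  have uniq: "a' = a \<and> b' = b"
    if a': "a' \<in> Poly_Mapping.keys f" and b': "b' \<in> Poly_Mapping.keys g" and eq: "a' + b' = a + b" for a' b'
  proof -
    have "\<iota> a' + \<iota> b' = \<iota> a + \<iota> b" using eq add by metis
    then have "\<iota> a' = \<iota> a"
      using a(2)[OF a'] b(2)[OF b'] by (metis add_less_le_mono order_le_less nless_le)
    then have "a' = a" using inj by (simp add: inj_eq)
    with eq show ?thesis by simp
  qed
  let ?s = "\<lambda>f m. Poly_Mapping.single m (Poly_Mapping.lookup f m)"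
  have prod: "f * g = (\<Sum>a\<in>Poly_Mapping.keys f. ?s f a) * (\<Sum>b\<in>Poly_Mapping.keys g. ?s g b)"
    by (simp only: sum_lookup_single)
  have "Poly_Mapping.lookup (f * g) (a + b)
      = (\<Sum>a'\<in>Poly_Mapping.keys f. \<Sum>b'\<in>Poly_Mapping.keys g.
          Poly_Mapping.lookup f a' * Poly_Mapping.lookup g b' when a' + b' = a + b)"
    by (simp only: prod sum_product mult_single lookup_sum lookup_single)
  also have "\<dots> = (\<Sum>a'\<in>Poly_Mapping.keys f. if a' = a then \<Sum>b'\<in>Poly_Mapping.keys g.
        if b' = b then Poly_Mapping.lookup f a * Poly_Mapping.lookup g b else 0 else 0)"
  proof (rule sum.cong[OF refl])
    fix a' assume a': "a' \<in> Poly_Mapping.keys f"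
    have "(Poly_Mapping.lookup f a' * Poly_Mapping.lookup g b' when a' + b' = a + b)
        = (if a' = a \<and> b' = b then Poly_Mapping.lookup f a * Poly_Mapping.lookup g b else 0)"
      if "b' \<in> Poly_Mapping.keys g" for b'
      using uniq[OF a' that] by (cases "a' + b' = a + b") auto
    then show "(\<Sum>b'\<in>Poly_Mapping.keys g.
          Poly_Mapping.lookup f a' * Poly_Mapping.lookup g b' when a' + b' = a + b)
        = (if a' = a then \<Sum>b'\<in>Poly_Mapping.keys g.
            if b' = b then Poly_Mapping.lookup f a * Poly_Mapping.lookup g b else 0 else 0)"
      by (cases "a' = a") simp_all
  qed
  also have "\<dots> = Poly_Mapping.lookup f a * Poly_Mapping.lookup g b"
    using a(1) b(1) by simp
  finally show ?thesis
    using that a(1) b(1) by (simp add: in_keys_iff)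
qed

text \<open>
  Induction on the number of terms of a quotient \<open>q\<close> of \<open>g\<^sup>p\<close> by \<open>h\<^sup>p\<close>. All exponents of \<open>g\<^sup>p\<close> and \<open>h\<^sup>p\<close> are multiples of
  \<open>p\<close> and all their coefficients are \<open>p\<close>-th powers. Comparing leading terms in \<open>g\<^sup>p = h\<^sup>p q\<close>, the
  leading monomial of \<open>q\<close> is the \<open>p\<close>-th power of some monomial \<open>x\<^sup>d\<close>, and by the root property of the
  coefficient ring its coefficient is \<open>c\<^sup>p\<close> for some \<open>c\<close>. Then \<open>(g - c x\<^sup>d h)\<^sup>p = h\<^sup>p (q - c\<^sup>p x\<^sup>p\<^sup>d)\<close>,
  where the new quotient has lost its leading term. Counting terms replaces the well-foundedness
  of a monomial order.
\<close>

lemma mpoly_power_CHAR_dvd_power: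
  fixes g h :: "('v::finite, 'k::idom) mpoly"
  assumes prime: "prime CHAR('k)" and p: "p = CHAR('k)"
    and root: "\<And>a b :: 'k. a ^ p dvd b ^ p \<Longrightarrow> a dvd b"
    and dvd: "h ^ p dvd g ^ p"
  shows "h dvd g"
proof -
  have p0: "p > 0" using prime p prime_gt_0_nat by blast
  note look = lookup_mpoly_power_CHAR[OF prime p]
  have power0: "f ^ p = 0 \<longleftrightarrow> f = 0" for f :: "('v, 'k) mpoly"
  proof
    assume "f ^ p = 0"
    then show "f = 0"
      using look[of f] p0 by (intro poly_mapping_eqI) (metis lookup_zero power_eq_0_iff)
  qed (use p0 in \<open>simp add: power_0_left\<close>)
  have prime': "prime CHAR(('v, 'k) mpoly)" and p': "p = CHAR(('v, 'k) mpoly)"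
    using prime p by (simp_all add: CHAR_poly_mapping)
  from dvd obtain q where "g ^ p = h ^ p * q" by (auto simp: dvd_def)
  then show ?thesis
  proof (induction "card (Poly_Mapping.keys q)" arbitrary: g q rule: less_induct)
    case less
    note gq = less.prems
    show ?case
    proof (cases "h = 0 \<or> q = 0")
      case True
      then have "h ^ p * q = 0"
        using power0[of h] by auto
      then have "g = 0"
        using power0[of g] gq by simp
      then show ?thesis by simp
    next
      case False
      then obtain M l where M: "Poly_Mapping.lookup (h ^ p) M \<noteq> 0" and l: "Poly_Mapping.lookup q l \<noteq> 0"
        and Ml: "Poly_Mapping.lookup (g ^ p) (M + l) = Poly_Mapping.lookup (h ^ p) M * Poly_Mapping.lookup q l"
        using mpoly_unique_product[of "h ^ p" q] power0[of h] gq by auto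
      obtain m where m: "M = (\<Sum>i<p. m)"
        using keys_mpoly_power_CHAR[OF prime p M] .
      have "Poly_Mapping.lookup (g ^ p) (M + l) \<noteq> 0"
        using M l Ml by simp
      then obtain m' where m': "M + l = (\<Sum>i<p. m')"
        using keys_mpoly_power_CHAR[OF prime p] by blast
      \<comment> \<open>The subtraction is truncated, but \<open>m\<close> is below \<open>m'\<close> because \<open>p m + l = p m'\<close>.\<close>
      define d where "d = m' - m"
      have "p * Poly_Mapping.lookup m v + Poly_Mapping.lookup l v = p * Poly_Mapping.lookup m' v" for v
        using arg_cong[OF m', of "\<lambda>x. Poly_Mapping.lookup x v"] by (simp add: m lookup_add lookup_sum)
      then have "Poly_Mapping.lookup l v = p * Poly_Mapping.lookup d v" for v
        by (metis d_def diff_add_inverse diff_mult_distrib2 lookup_minus)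
      then have ld: "l = (\<Sum>i<p. d)"
        by (intro poly_mapping_eqI) (simp add: lookup_sum)
      let ?a = "Poly_Mapping.lookup h m" and ?b = "Poly_Mapping.lookup g m'"
      have ab: "?b ^ p = ?a ^ p * Poly_Mapping.lookup q l"
        using Ml unfolding m' unfolding m look .
      then obtain c where c: "?b = ?a * c"
        using root[of ?a ?b] by (auto simp: dvd_def)
      have "?a \<noteq> 0" using M p0 unfolding m look by auto
      then have cq: "Poly_Mapping.lookup q l = c ^ p"
        using ab unfolding c by (simp add: power_mult_distrib)
      define g' where "g' = g - Poly_Mapping.single d c * h"
      define q' where "q' = q - Poly_Mapping.single l (Poly_Mapping.lookup q l)"
      have "g ^ p = g' ^ p + (Poly_Mapping.single d c * h) ^ p"
        using freshmans_dream[OF prime' p', of g' "Poly_Mapping.single d c * h"] by (simp add: g'_def)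
      then have "g' ^ p = h ^ p * q'"
        by (simp add: gq q'_def power_mult_distrib single_power cq[unfolded ld] ld algebra_simps)
      moreover have "Poly_Mapping.keys q' \<subset> Poly_Mapping.keys q"
      proof -
        have "Poly_Mapping.keys q' \<subseteq> Poly_Mapping.keys q - {l}"
          by (auto simp: q'_def in_keys_iff lookup_minus lookup_single when_def split: if_splits)
        moreover have "l \<in> Poly_Mapping.keys q" using l by (simp add: in_keys_iff)
        ultimately show ?thesis by blast
      qed
      then have "card (Poly_Mapping.keys q') < card (Poly_Mapping.keys q)"
        by (intro psubset_card_mono) auto
      ultimately have "h dvd g'" using less.hyps by blast
      then have "h dvd g' + Poly_Mapping.single d c * h" by simp
      then show ?thesis by (simp add: g'_def)
    qed
  qed
qed

section \<open>Integrability along a principal ideal and along its Frobenius power\<close>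

theorem proposition2p10:
  fixes h :: "('v::finite, 'k::{idom, factorial_semiring}) mpoly"
    and p :: nat
    and n :: enat
  assumes "CHAR('k) = p" and "p > 0"
    and "n \<ge> 1"
  shows "IDer_log mpoly_scale (principal_ideal h) n
       = IDer_log mpoly_scale (principal_ideal (h ^ p)) (n * enat p)"
proof -
  have prime: "prime CHAR('k)" and p: "p = CHAR('k)"
    using assms prime_CHAR_semidom by auto
  have prime': "prime CHAR(('v, 'k) mpoly)" and p': "p = CHAR(('v, 'k) mpoly)"
    using prime p by (simp_all add: CHAR_poly_mapping)
  have n1: "enat 1 \<le> n"
    using assms(3) by (simp add: one_enat_def)
  have nle: "n \<le> n * enat p"
    using assms(2) by (cases n) auto
  have root: "h dvd g \<longleftrightarrow> h ^ p dvd g ^ p" for g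
    using mpoly_power_CHAR_dvd_power[OF prime p, of h g] factorial_power_dvd_power[OF _ assms(2)]
    by (auto intro: dvd_power_same)
  have key: "(\<exists>D \<in> HS_log mpoly_scale (principal_ideal h) n. D 1 = \<delta>)
    \<longleftrightarrow> (\<exists>E \<in> HS_log mpoly_scale (principal_ideal (h ^ p)) (n * enat p). E 1 = \<delta>)" for \<delta>
  proof
    assume "\<exists>D \<in> HS_log mpoly_scale (principal_ideal h) n. D 1 = \<delta>"
    then obtain D where D: "D \<in> HS_log mpoly_scale (principal_ideal h) n" "D 1 = \<delta>" by blast
    then have DHS: "D \<in> HS mpoly_scale n" by (simp add: HS_log_def)
    obtain E where E: "E \<in> HS mpoly_scale \<infinity>" "\<And>i f. enat i \<le> n \<Longrightarrow> E i f = D i f"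
      using HS_mpoly_extend[OF DHS] by blast
    let ?E = "restrict E {i. enat i \<le> n * enat p}"
    have EHS: "?E \<in> HS mpoly_scale (n * enat p)"
      using HS_restrict[OF E(1)] by simp
    have ED: "?E i f = D i f" if "enat i \<le> n" for i f
      using that nle E(2) order_trans by auto
    have "?E \<in> HS_log mpoly_scale (principal_ideal (h ^ p)) (n * enat p)"
      unfolding HS_log_power_CHAR_iff[OF EHS prime' p']
      using D(1) ED root unfolding HS_log_principal_iff[OF DHS] by metis
    moreover have "?E 1 = \<delta>"
      using ED[OF n1] D(2) by auto
    ultimately show "\<exists>E \<in> HS_log mpoly_scale (principal_ideal (h ^ p)) (n * enat p). E 1 = \<delta>" by blast
  next
    assume "\<exists>E \<in> HS_log mpoly_scale (principal_ideal (h ^ p)) (n * enat p). E 1 = \<delta>"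
    then obtain E where E: "E \<in> HS_log mpoly_scale (principal_ideal (h ^ p)) (n * enat p)" "E 1 = \<delta>"
      by blast
    then have EHS: "E \<in> HS mpoly_scale (n * enat p)" by (simp add: HS_log_def)
    let ?D = "restrict E {i. enat i \<le> n}"
    have "?D \<in> HS_log mpoly_scale (principal_ideal h) n"
      unfolding HS_log_principal_iff[OF HS_restrict[OF EHS nle]]
      using E(1) root unfolding HS_log_power_CHAR_iff[OF EHS prime' p'] by simp
    moreover have "?D 1 = \<delta>"
      using n1 E(2) by simp
    ultimately show "\<exists>D \<in> HS_log mpoly_scale (principal_ideal h) n. D 1 = \<delta>" by blast
  qed
  show ?thesis
    unfolding IDer_log_def key ..
qed

end
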